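(* Consider the robust problem (RO), its decision diagram $\mathcal{D}^R$, the separation oracle $\mathscr{S}$, and the state-augmenting algorithm described in the context. The algorithm terminates in a finite number of iterations. The number of calls to the separation oracle $\mathscr{S}(\cdot)$ is bounded above by the number of infeasible paths of $\mathcal{D}^R$ with respect to the side constraints $G(\delta)y\le b(\delta)$, $\delta\in\Delta$ (i.e., the number of $\mathbf{r}$-$\mathbf{t}$ paths of $\mathcal{D}^R$ violating at least one of these constraints).
   Context: (RO) is $\min_{x\in\mathcal{X}}\{f(x):A(\delta)x\le b(\delta)\ \forall\delta\in\Delta\}$ where $\mathcal{X}\subseteq\mathbb{Z}^n$ is finite, $\Delta$ is a (possibly infinite) uncertainty set, $A(\delta)\in\mathbb{R}^{r\times n}$ with rows $a_i(\delta)$ and entries $a_{i,j}(\delta)$, $b(\delta)\in\mathbb{R}^r$. A decision diagram $\mathcal{D}=(\mathcal{N},\mathcal{A},\nu,l)$ with $n\ge 1$ variables is a finite acyclic directed graph (parallel arcs allowed) with node set partitioned into layers $\mathcal{N}_1,\dots,\mathcal{N}_{n+1}$, $\mathcal{N}_1=\{\mathbf{r}\}$, $\mathcal{N}_{n+1}=\{\mathbf{t}\}$. Each arc $a$ goes from a tail in some layer $\mathcal{N}_j$ to a head in $\mathcal{N}_{j+1}$; $\tau_a:=j$. Arc $a$ has a value $\nu_a\in\mathbb{Z}$ and a length $l_a\in\mathbb{R}$. $\mathcal{D}^R$ encodes $\min\{f(x):x\in\mathcal{X}\}$: $(a_1,\dots,a_n)\mapsto(\nu_{a_1},\dots,\nu_{a_n})$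 is a one-to-one correspondence between $\mathbf{r}$-$\mathbf{t}$ paths and $\mathcal{X}$, and path lengths equal $f$ of the corresponding solutions. $G(\delta)\in\mathbb{R}^{r\times|\mathcal{A}|}$ has entries $g_{i,a}(\delta)=\nu_a a_{i,\tau_a}(\delta)$; a path is identified with its arc-incidence vector $y\in\{0,1\}^{|\mathcal{A}|}$. As in all constrained shortest-path models considered, $G(\delta)$ and $b(\delta)$ are assumed non-negative, and at least one $\mathbf{r}$-$\mathbf{t}$ path satisfies $G(\delta)y\le b(\delta)$ for all $\delta\in\Delta$. Separation oracle: in finite time, $\mathscr{S}(x)$ returns some pair $(i,\delta)\in\{1,\dots,r\}\times\Delta$ with $a_i(\delta)x>b_i(\delta)$ if such a pair exists, and $\emptyset$ otherwise. For $\Delta'\subseteq\Delta$, let CSP$(\Delta')$ be the problem of finding a minimum-length $\mathbf{r}$-$\mathbf{t}$ path of $\mathcal{D}^R$ satisfying $G(\delta)y\le b(\delta)$ for all $\delta\in\Delta'$ (solved via the equivalent dynamic program whose state vector stores the accumulated left-hand sides for each $\delta\in\Delta'$). State-augmenting algorithm: set $\Delta_1=\emptyset$, $t=1$, and let $x^*=(\nu_{a_1},\dots,\nu_{a_n})$ be derived from an optimal path $(a_1,\dots,a_n)$ of CSP$(\Delta_1)$. While $\mathscr{S}(x^* )=(i,\delta)\ne\emptyset$: set $\Delta_{t+1}=\Delta_t\cup\{\delta\}$, solve CSP$(\Delta_{t+1})$, let $x^*$ be the solution associated with the optimal path found, and set $t:=t+1$. Return $x^*$.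
   Formalization: The bound by the number of infeasible paths is stated for oracle calls that return a violated pair; counting also the final call that returns the empty answer, the bound is that number plus one (with no infeasible path the oracle is still called once). *)

theory Defs
  imports "Graph_Theory.Arc_Walk" "Jordan_Normal_Form.Matrix"
begin

text \<open>
  Rows, columns and layers are numbered from 0: rows are \<open>{..<r}\<close>, variables are
  \<open>{..<n}\<close> and layers are \<open>{..n}\<close>, so that the arcs leaving layer \<open>j\<close> carry the values of
  the variable with index \<open>j\<close>.
\<close>

section \<open>Robust problems\<close>

record 'd robust_problem =
  nvars :: nat
  nrows :: nat
  sols  :: "int vec set"
  obj   :: "int vec \<Rightarrow> real"
  unc   :: "'d set"
  lhs   :: "'d \<Rightarrow> real mat"
  rhs   :: "'d \<Rightarrow> real vec"

definition wf_robust_problem :: "'d robust_problem \<Rightarrow> bool" where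
  "wf_robust_problem P \<longleftrightarrow>
     nvars P \<ge> 1 \<and>
     sols P \<subseteq> carrier_vec (nvars P) \<and> finite (sols P) \<and>
     (\<forall>\<delta>\<in>unc P. lhs P \<delta> \<in> carrier_mat (nrows P) (nvars P) \<and> rhs P \<delta> \<in> carrier_vec (nrows P))"

definition violates :: "'d robust_problem \<Rightarrow> int vec \<Rightarrow> nat \<Rightarrow> 'd \<Rightarrow> bool" where
  "violates P x i \<delta> \<longleftrightarrow> row (lhs P \<delta>) i \<bullet> map_vec real_of_int x > rhs P \<delta> $ i"

text \<open>The answer \<open>None\<close> stands for the empty answer.\<close>

definition separation_oracle ::
    "'d robust_problem \<Rightarrow> (int vec \<Rightarrow> (nat \<times> 'd) option) \<Rightarrow> bool" where
  "separation_oracle P S \<longleftrightarrow>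
     (\<forall>x\<in>sols P.
        if \<exists>i<nrows P. \<exists>\<delta>\<in>unc P. violates P x i \<delta>
        then \<exists>i<nrows P. \<exists>\<delta>\<in>unc P. S x = Some (i, \<delta>) \<and> violates P x i \<delta>
        else S x = None)"

section \<open>Decision diagrams\<close>

text \<open>Arcs are abstract objects with a tail and a head, hence parallel arcs are allowed.\<close>

record ('v, 'a) decision_diagram =
  graph    :: "('v, 'a) pre_digraph"
  layer    :: "'v \<Rightarrow> nat"
  root     :: 'v
  terminal :: 'v
  val      :: "'a \<Rightarrow> int"
  len      :: "'a \<Rightarrow> real"

definition wf_decision_diagram :: "nat \<Rightarrow> ('v, 'a) decision_diagram \<Rightarrow> bool" where
  "wf_decision_diagram n D \<longleftrightarrow>
     n \<ge> 1 \<and> fin_digraph (graph D) \<and> acyclic (arcs_ends (graph D)) \<and>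
     (\<forall>v\<in>verts (graph D). layer D v \<le> n) \<and>
     {v \<in> verts (graph D). layer D v = 0} = {root D} \<and>
     {v \<in> verts (graph D). layer D v = n} = {terminal D} \<and>
     (\<forall>a\<in>arcs (graph D). layer D (head (graph D) a) = layer D (tail (graph D) a) + 1)"

definition arc_layer :: "('v, 'a) decision_diagram \<Rightarrow> 'a \<Rightarrow> nat" where
  "arc_layer D a = layer D (tail (graph D) a)"

definition rt_paths :: "('v, 'a) decision_diagram \<Rightarrow> 'a list set" where
  "rt_paths D = {p. pre_digraph.apath (graph D) (root D) p (terminal D)}"

definition path_length :: "('v, 'a) decision_diagram \<Rightarrow> 'a list \<Rightarrow> real" where
  "path_length D p = (\<Sum>a\<leftarrow>p. len D a)"

definition path_sol :: "('v, 'a) decision_diagram \<Rightarrow> 'a list \<Rightarrow> int vec" where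
  "path_sol D p = vec_of_list (map (val D) p)"

definition encodes :: "('v, 'a) decision_diagram \<Rightarrow> 'd robust_problem \<Rightarrow> bool" where
  "encodes D P \<longleftrightarrow>
     bij_betw (path_sol D) (rt_paths D) (sols P) \<and>
     (\<forall>p\<in>rt_paths D. path_length D p = obj P (path_sol D p))"

section \<open>Constrained shortest paths\<close>

definition side_coeff ::
    "'d robust_problem \<Rightarrow> ('v, 'a) decision_diagram \<Rightarrow> 'd \<Rightarrow> nat \<Rightarrow> 'a \<Rightarrow> real" where
  "side_coeff P D \<delta> i a = real_of_int (val D a) * lhs P \<delta> $$ (i, arc_layer D a)"

definition incidence :: "'a list \<Rightarrow> 'a \<Rightarrow> real" where
  "incidence p a = (if a \<in> set p then 1 else 0)"

definition satisfies_side ::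
    "'d robust_problem \<Rightarrow> ('v, 'a) decision_diagram \<Rightarrow> 'd \<Rightarrow> 'a list \<Rightarrow> bool" where
  "satisfies_side P D \<delta> p \<longleftrightarrow>
     (\<forall>i<nrows P. (\<Sum>a\<in>arcs (graph D). side_coeff P D \<delta> i a * incidence p a) \<le> rhs P \<delta> $ i)"

definition csp_paths ::
    "'d robust_problem \<Rightarrow> ('v, 'a) decision_diagram \<Rightarrow> 'd set \<Rightarrow> 'a list set" where
  "csp_paths P D \<Delta>' = {p \<in> rt_paths D. \<forall>\<delta>\<in>\<Delta>'. satisfies_side P D \<delta> p}"

definition csp_optimal ::
    "'d robust_problem \<Rightarrow> ('v, 'a) decision_diagram \<Rightarrow> 'd set \<Rightarrow> 'a list \<Rightarrow> bool" where
  "csp_optimal P D \<Delta>' p \<longleftrightarrow> is_arg_min (path_length D) (\<lambda>q. q \<in> csp_paths P D \<Delta>') p"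

definition infeasible_paths ::
    "'d robust_problem \<Rightarrow> ('v, 'a) decision_diagram \<Rightarrow> 'a list set" where
  "infeasible_paths P D = {p \<in> rt_paths D. \<exists>\<delta>\<in>unc P. \<not> satisfies_side P D \<delta> p}"

definition nonneg_side ::
    "'d robust_problem \<Rightarrow> ('v, 'a) decision_diagram \<Rightarrow> bool" where
  "nonneg_side P D \<longleftrightarrow>
     (\<forall>\<delta>\<in>unc P. \<forall>i<nrows P.
        (\<forall>a\<in>arcs (graph D). side_coeff P D \<delta> i a \<ge> 0) \<and> rhs P \<delta> $ i \<ge> 0)"

section \<open>The state-augmenting algorithm\<close>

text \<open>
  \<open>Loop t \<Delta>\<^sub>t p\<close> is the situation just before the loop guard is evaluated, where \<open>p\<close> is the
  optimal path found for the constrained shortest path problem over \<open>\<Delta>\<^sub>t\<close>, so that the current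
  solution is \<open>path_sol D p\<close>.  Any optimal path may be found.  Every step evaluates the guard
  once, that is, it makes exactly one oracle call; the step is labelled with the answer.
\<close>

datatype ('d, 'a) config = Loop nat "'d set" "'a list" | Returned "int vec"

inductive sa_init ::
    "'d robust_problem \<Rightarrow> ('v, 'a) decision_diagram \<Rightarrow> ('d, 'a) config \<Rightarrow> bool"
  for P D where
  "csp_optimal P D {} p \<Longrightarrow> sa_init P D (Loop 1 {} p)"

inductive sa_step ::
    "'d robust_problem \<Rightarrow> ('v, 'a) decision_diagram \<Rightarrow> (int vec \<Rightarrow> (nat \<times> 'd) option) \<Rightarrow>
     ('d, 'a) config \<Rightarrow> (nat \<times> 'd) option \<Rightarrow> ('d, 'a) config \<Rightarrow> bool"
  for P D S where
  augment: "S (path_sol D p) = Some (i, \<delta>) \<Longrightarrow> csp_optimal P D (\<Delta>\<^sub>t \<union> {\<delta>}) p' \<Longrightarrow>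
     sa_step P D S (Loop t \<Delta>\<^sub>t p) (Some (i, \<delta>)) (Loop (t + 1) (\<Delta>\<^sub>t \<union> {\<delta>}) p')"
| return: "S (path_sol D p) = None \<Longrightarrow>
     sa_step P D S (Loop t \<Delta>\<^sub>t p) None (Returned (path_sol D p))"

text \<open>
  A partial execution from the start of the algorithm, with the list of the answers to the
  oracle calls made so far, in order.  The answer \<open>None\<close> can only come last: that call ends
  the loop and cuts off no path, all others belong to an iteration of the loop.
\<close>

inductive sa_exec ::
    "'d robust_problem \<Rightarrow> ('v, 'a) decision_diagram \<Rightarrow> (int vec \<Rightarrow> (nat \<times> 'd) option) \<Rightarrow>
     (nat \<times> 'd) option list \<Rightarrow> ('d, 'a) config \<Rightarrow> bool"
  for P D S where
  "sa_init P D c \<Longrightarrow> sa_exec P D S [] c"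
| "sa_exec P D S as c \<Longrightarrow> sa_step P D S c ans c' \<Longrightarrow> sa_exec P D S (as @ [ans]) c'"

text \<open>
  Termination: the first constrained shortest path problem has an optimal path, no execution
  runs forever, and an execution stops only by returning a solution (in particular it never
  gets stuck on a constrained shortest path problem without optimal path).
\<close>

definition sa_terminates ::
    "'d robust_problem \<Rightarrow> ('v, 'a) decision_diagram \<Rightarrow> (int vec \<Rightarrow> (nat \<times> 'd) option) \<Rightarrow> bool" where
  "sa_terminates P D S \<longleftrightarrow>
     (\<exists>c. sa_init P D c) \<and>
     (\<nexists>c ans. sa_init P D (c 0) \<and> (\<forall>k::nat. sa_step P D S (c k) (ans k) (c (Suc k)))) \<and>
     (\<forall>as c. sa_exec P D S as c \<longrightarrow>
        (\<exists>x. c = Returned x) \<or> (\<exists>ans c'. sa_step P D S c ans c'))"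

end

theory Submission
  imports Defs
begin

text \<open>
  A root-terminal path picks exactly one arc per layer, and its arc in layer \<open>j\<close> carries the
  value of variable \<open>j\<close>.  Hence the left-hand side of a side constraint at the incidence vector
  of the path equals the left-hand side of the corresponding robust constraint at the solution
  of the path (\<open>side_lhs_eq_row\<close>).  So an oracle answer \<open>(i, \<delta>)\<close> for the solution of the current
  path \<open>p\<close> says precisely that \<open>p\<close> violates a side constraint of \<open>\<delta>\<close>.

  The bound is then a counting argument.  Let \<open>cut_paths \<Delta>'\<close> be the paths excluded by the
  scenarios in \<open>\<Delta>'\<close>.  The current path satisfies the side constraints of all scenarios
  collected so far but not those of the new one, so every iteration adds at least one path to
  this set.  All excluded paths are infeasible, so there are at most as many iterations as
  infeasible paths; the single further oracle call is the one that certifies robust feasibility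
  of the returned solution.  Finally, no iteration gets stuck: a path that is feasible for all
  scenarios is feasible for every intermediate problem, and there are only finitely many paths,
  one for each solution, so an optimal one exists.
\<close>

section \<open>Side constraints along a path\<close>

lemma cas_layers:
  assumes wf: "wf_decision_diagram n D"
    and "set p \<subseteq> arcs (graph D)" "pre_digraph.cas (graph D) u p v"
  shows "layer D v = layer D u + length p \<and>
    (\<forall>j<length p. arc_layer D (p ! j) = layer D u + j)"
  using assms(2,3)
proof (induction p arbitrary: u)
  case Nil
  then show ?case by (simp add: pre_digraph.cas.simps)
next
  case (Cons a p)
  have tail: "tail (graph D) a = u" and cas: "pre_digraph.cas (graph D) (head (graph D) a) p v"
    using Cons.prems by (simp_all add: pre_digraph.cas.simps)
  have "layer D (head (graph D) a) = layer D u + 1"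
    using wf Cons.prems(1) tail by (auto simp: wf_decision_diagram_def)
  with Cons.IH[OF _ cas] Cons.prems(1) tail show ?case
    by (auto simp: nth_Cons arc_layer_def split: nat.split)
qed

lemma rt_path_layers:
  assumes wf: "wf_decision_diagram n D" and p: "p \<in> rt_paths D"
  shows "set p \<subseteq> arcs (graph D)" "length p = n" "j < n \<Longrightarrow> arc_layer D (p ! j) = j" "distinct p"
proof -
  have awalk: "pre_digraph.awalk (graph D) (root D) p (terminal D)"
    using p by (simp add: rt_paths_def pre_digraph.apath_def)
  show arcs: "set p \<subseteq> arcs (graph D)"
    using awalk by (simp add: pre_digraph.awalk_def)
  have cas: "pre_digraph.cas (graph D) (root D) p (terminal D)"
    using awalk by (simp add: pre_digraph.awalk_def)
  have "layer D (root D) = 0" "layer D (terminal D) = n"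
    using wf by (auto simp: wf_decision_diagram_def)
  with cas_layers[OF wf arcs cas]
  have len: "length p = n" and lay: "\<And>j. j < n \<Longrightarrow> arc_layer D (p ! j) = j"
    by auto
  show "length p = n" by (rule len)
  show "j < n \<Longrightarrow> arc_layer D (p ! j) = j" by (rule lay)
  show "distinct p"
    unfolding distinct_conv_nth len by (metis lay)
qed

text \<open>
  Both sides are sums over the arcs of the path: on the left the incidence vector selects them
  among all arcs, on the right they are indexed by their layers.
\<close>

lemma side_lhs_eq_row:
  assumes wfP: "wf_robust_problem P" and wfD: "wf_decision_diagram (nvars P) D"
    and p: "p \<in> rt_paths D" and \<delta>: "\<delta> \<in> unc P" and i: "i < nrows P"
  shows "(\<Sum>a\<in>arcs (graph D). side_coeff P D \<delta> i a * incidence p a) =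
    row (lhs P \<delta>) i \<bullet> map_vec real_of_int (path_sol D p)"
proof -
  note path = rt_path_layers[OF wfD p]
  have fin: "finite (arcs (graph D))"
    using wfD by (auto simp: wf_decision_diagram_def dest: fin_digraph.finite_arcs)
  have mat: "lhs P \<delta> \<in> carrier_mat (nrows P) (nvars P)"
    using wfP \<delta> by (simp add: wf_robust_problem_def)
  have "(\<Sum>a\<in>arcs (graph D). side_coeff P D \<delta> i a * incidence p a) =
      (\<Sum>a\<in>set p. side_coeff P D \<delta> i a)"
    using path(1) fin by (intro sum.mono_neutral_cong_right) (auto simp: incidence_def)
  also have "\<dots> = (\<Sum>j<nvars P. side_coeff P D \<delta> i (p ! j))"
    using path(2,4) by (intro sum.reindex_bij_betw[symmetric] bij_betw_nth) auto
  also have "\<dots> = row (lhs P \<delta>) i \<bullet> map_vec real_of_int (path_sol D p)"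
    using path(2,3) mat i
    by (auto simp: scalar_prod_def path_sol_def side_coeff_def vec_of_list_index
        lessThan_atLeast0 mult.commute intro!: sum.cong)
  finally show ?thesis .
qed

lemma violates_iff_not_satisfies_side:
  assumes "wf_robust_problem P" "wf_decision_diagram (nvars P) D"
    and "p \<in> rt_paths D" "\<delta> \<in> unc P"
  shows "(\<exists>i<nrows P. violates P (path_sol D p) i \<delta>) \<longleftrightarrow> \<not> satisfies_side P D \<delta> p"
  using side_lhs_eq_row[OF assms]
  by (auto simp: violates_def satisfies_side_def not_le)

lemma oracle_answer_cuts_path:
  assumes "wf_robust_problem P" "wf_decision_diagram (nvars P) D"
    and enc: "encodes D P" and orc: "separation_oracle P S"
    and p: "p \<in> rt_paths D" and ans: "S (path_sol D p) = Some (i, \<delta>)"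
  shows "\<delta> \<in> unc P" "\<not> satisfies_side P D \<delta> p"
proof -
  have "path_sol D p \<in> sols P"
    using enc p by (auto simp: encodes_def bij_betw_def)
  with orc ans have "i < nrows P \<and> \<delta> \<in> unc P \<and> violates P (path_sol D p) i \<delta>"
    by (fastforce simp: separation_oracle_def split: if_splits)
  with violates_iff_not_satisfies_side[OF assms(1,2) p]
  show "\<delta> \<in> unc P" "\<not> satisfies_side P D \<delta> p" by auto
qed

section \<open>Optimal paths exist\<close>

lemma finite_rt_paths:
  assumes "wf_robust_problem P" "encodes D P"
  shows "finite (rt_paths D)"
  using assms bij_betw_finite by (auto simp: wf_robust_problem_def encodes_def)

lemma csp_optimal_exists:
  assumes fin: "finite (rt_paths D)" and feas: "csp_paths P D (unc P) \<noteq> {}"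
    and sub: "\<Delta>' \<subseteq> unc P"
  shows "\<exists>p. csp_optimal P D \<Delta>' p"
proof -
  have "finite (csp_paths P D \<Delta>')" using fin by (simp add: csp_paths_def)
  moreover have "csp_paths P D \<Delta>' \<noteq> {}" using feas sub by (auto simp: csp_paths_def)
  ultimately obtain p where "is_arg_min (path_length D) (\<lambda>q. q \<in> csp_paths P D \<Delta>') p"
    using ex_is_arg_min_if_finite by metis
  then show ?thesis by (auto simp: csp_optimal_def)
qed

section \<open>Counting excluded paths\<close>

definition cut_paths ::
    "'d robust_problem \<Rightarrow> ('v, 'a) decision_diagram \<Rightarrow> 'd set \<Rightarrow> 'a list set" where
  "cut_paths P D \<Delta>' = rt_paths D - csp_paths P D \<Delta>'"

lemma card_cut_paths_le_infeasible:
  assumes "finite (rt_paths D)" "\<Delta>' \<subseteq> unc P"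
  shows "card (cut_paths P D \<Delta>') \<le> card (infeasible_paths P D)"
  using assms
  by (intro card_mono) (auto simp: cut_paths_def csp_paths_def infeasible_paths_def)

lemma card_cut_paths_insert:
  assumes "finite (rt_paths D)" "p \<in> csp_paths P D \<Delta>'" "\<not> satisfies_side P D \<delta> p"
  shows "card (cut_paths P D \<Delta>') < card (cut_paths P D (\<Delta>' \<union> {\<delta>}))"
  using assms
  by (intro psubset_card_mono) (auto simp: cut_paths_def csp_paths_def)

text \<open>
  The invariant behind the bound.  Inside the loop every answer so far has been a scenario, and
  each of them has excluded at least one further path; the answer \<open>None\<close> is the last one and
  excludes nothing.
\<close>

lemma sa_exec_invariant:
  assumes wfP: "wf_robust_problem P" and wfD: "wf_decision_diagram (nvars P) D"
    and enc: "encodes D P" and orc: "separation_oracle P S"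
    and exec: "sa_exec P D S as c"
  shows "case c of
      Loop t \<Delta>' p \<Rightarrow> \<Delta>' \<subseteq> unc P \<and> csp_optimal P D \<Delta>' p \<and> None \<notin> set as \<and>
        length as \<le> card (cut_paths P D \<Delta>')
    | Returned x \<Rightarrow> \<exists>as'. as = as' @ [None] \<and> None \<notin> set as' \<and>
        length as' \<le> card (infeasible_paths P D)"
  using exec
proof induction
  case (1 c)
  then show ?case by (auto elim: sa_init.cases)
next
  case (2 as c ans c')
  note fin = finite_rt_paths[OF wfP enc]
  from 2(2) show ?case
  proof cases
    case (augment p i \<delta> \<Delta>' p' t)
    have inv: "\<Delta>' \<subseteq> unc P" "csp_optimal P D \<Delta>' p" "None \<notin> set as"
        "length as \<le> card (cut_paths P D \<Delta>')"
      using 2(3) augment by auto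
    have p: "p \<in> csp_paths P D \<Delta>'"
      using inv(2) by (simp add: csp_optimal_def is_arg_min_def)
    then have "p \<in> rt_paths D" by (simp add: csp_paths_def)
    from oracle_answer_cuts_path[OF wfP wfD enc orc this]
    have \<delta>: "\<delta> \<in> unc P" "\<not> satisfies_side P D \<delta> p" using augment by auto
    show ?thesis
      using card_cut_paths_insert[OF fin p \<delta>(2)] inv \<delta>(1) augment by auto
  next
    case (return p t \<Delta>')
    then show ?thesis
      using 2(3) card_cut_paths_le_infeasible[OF fin, of \<Delta>' P] by force
  qed
qed

lemma oracle_calls_bound:
  assumes "wf_robust_problem P" "wf_decision_diagram (nvars P) D"
    and "encodes D P" "separation_oracle P S" "sa_exec P D S as c"
  shows "length (filter (\<lambda>ans. ans \<noteq> None) as) \<le> card (infeasible_paths P D) \<and>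
    length as \<le> card (infeasible_paths P D) + 1"
proof (cases c)
  case (Loop t \<Delta>' p)
  with sa_exec_invariant[OF assms] have "\<Delta>' \<subseteq> unc P" "length as \<le> card (cut_paths P D \<Delta>')"
    by auto
  with card_cut_paths_le_infeasible[OF finite_rt_paths[OF assms(1,3)]]
  have "length as \<le> card (infeasible_paths P D)" by (meson order_trans)
  then show ?thesis
    using length_filter_le[of "\<lambda>ans. ans \<noteq> None" as] by linarith
next
  case (Returned x)
  with sa_exec_invariant[OF assms] obtain as' where
    as: "as = as' @ [None]" "length as' \<le> card (infeasible_paths P D)" by auto
  have "length (filter (\<lambda>ans. ans \<noteq> None) as) \<le> length as'"
    unfolding as(1) using length_filter_le[of "\<lambda>ans. ans \<noteq> None" as'] by simp
  also note as(2)
  finally show ?thesis using as by simp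
qed

section \<open>Termination\<close>

lemma sa_exec_of_run:
  assumes "sa_init P D (c 0)" "\<And>k::nat. sa_step P D S (c k) (ans k) (c (Suc k))"
  shows "sa_exec P D S (map ans [0..<k]) (c k)"
proof (induction k)
  case 0
  then show ?case using assms(1) by (auto intro: sa_exec.intros)
next
  case (Suc k)
  then show ?case using sa_exec.intros(2)[OF Suc assms(2)] by simp
qed

lemma sa_progress:
  assumes wfP: "wf_robust_problem P" and wfD: "wf_decision_diagram (nvars P) D"
    and enc: "encodes D P" and orc: "separation_oracle P S"
    and feas: "csp_paths P D (unc P) \<noteq> {}"
    and exec: "sa_exec P D S as (Loop t \<Delta>' p)"
  shows "\<exists>ans c'. sa_step P D S (Loop t \<Delta>' p) ans c'"
proof (cases "S (path_sol D p)")
  case None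
  then show ?thesis by (blast intro: sa_step.return)
next
  case (Some answer)
  then obtain i \<delta> where ans: "S (path_sol D p) = Some (i, \<delta>)" by (cases answer) auto
  have inv: "\<Delta>' \<subseteq> unc P" "csp_optimal P D \<Delta>' p"
    using sa_exec_invariant[OF wfP wfD enc orc exec] by auto
  have "p \<in> rt_paths D"
    using inv(2) by (simp add: csp_optimal_def is_arg_min_def csp_paths_def)
  from oracle_answer_cuts_path(1)[OF wfP wfD enc orc this ans] inv(1)
  have "\<Delta>' \<union> {\<delta>} \<subseteq> unc P" by simp
  from csp_optimal_exists[OF finite_rt_paths[OF wfP enc] feas this]
  obtain p' where "csp_optimal P D (\<Delta>' \<union> {\<delta>}) p'" by blast
  with ans show ?thesis by (blast intro: sa_step.augment)
qed

theorem proposition10: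
  fixes P :: "'d robust_problem"
    and D :: "('v, 'a) decision_diagram"
    and S :: "int vec \<Rightarrow> (nat \<times> 'd) option"
  assumes "wf_robust_problem P"
    and "wf_decision_diagram (nvars P) D"
    and "encodes D P"
    and "nonneg_side P D"
    and "csp_paths P D (unc P) \<noteq> {}"
    and "separation_oracle P S"
  shows "sa_terminates P D S \<and>
    (\<forall>as c. sa_exec P D S as c \<longrightarrow>
       length (filter (\<lambda>ans. ans \<noteq> None) as) \<le> card (infeasible_paths P D) \<and>
       length as \<le> card (infeasible_paths P D) + 1)"
proof -
  note bound = oracle_calls_bound[OF assms(1-3,6)]
  have start: "\<exists>c. sa_init P D c"
    using csp_optimal_exists[OF finite_rt_paths[OF assms(1,3)] assms(5), of "{}"]
    by (auto intro: sa_init.intros)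
  have no_infinite_run: "\<nexists>c ans. sa_init P D (c 0) \<and> (\<forall>k::nat. sa_step P D S (c k) (ans k) (c (Suc k)))"
  proof
    assume "\<exists>c ans. sa_init P D (c 0) \<and> (\<forall>k::nat. sa_step P D S (c k) (ans k) (c (Suc k)))"
    then obtain c ans where run: "sa_init P D (c 0)" "\<And>k::nat. sa_step P D S (c k) (ans k) (c (Suc k))"
      by blast
    \<comment> \<open>A prefix of the run with one oracle call more than the bound allows.\<close>
    from bound[OF sa_exec_of_run[where c = c and ans = ans, OF run, of "card (infeasible_paths P D) + 2"]]
    show False by simp
  qed
  have progress: "(\<exists>x. c = Returned x) \<or> (\<exists>ans c'. sa_step P D S c ans c')"
    if "sa_exec P D S as c" for as c
    using that sa_progress[OF assms(1-3,6,5)] by (cases c) auto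
  show ?thesis
    using start no_infinite_run progress bound unfolding sa_terminates_def by blast
qed

end
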